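(* Let $\varphi=\frac{1+\sqrt5}{2}$. Consider the following algorithm (extension of List Scheduling): consider the jobs in any order; for the next job $j$, test $j$ if and only if $u_j/t_j\ge\varphi$ (otherwise run it untested), and execute it completely on a currently least-loaded machine. For every $m\ge1$, this algorithm is $\varphi\left(2-\frac1m\right)$-competitive for non-preemptive makespan minimization on $m$ identical machines with (general, non-uniform) testing times. Moreover, this analysis is tight: for every $m$ there is an instance and an order of the jobs on which the algorithm's makespan equals $\varphi\left(2-\frac1m\right)\mathrm{OPT}$.
   Context: Scheduling with testing on $m$ identical parallel machines: there are $n$ jobs; each job $j$ has a testing time $t_j\ge 0$, an upper bound $u_j\ge 0$ and a processing time $p_j$ with $0\le p_j\le u_j$. A job can either be run untested, occupying a machine for time $u_j$, or be tested and then executed, occupying a machine for total time $t_j+p_j$; the value $p_j$ is revealed to the algorithm only when the test of $j$ is completed. Initially the algorithm knows $m$, $n$ and all $t_j,u_j$, but not the $p_j$. In the non-preemptive setting each job is assigned to a single machine and run there without interruption. The objective is the makespan (maximum machine load). $\mathrm{OPT}$ denotes the minimum makespan achievable by an offline scheduler knowing all $p_j$ (job $j$ needs time $\min(t_j+p_j,u_j)$ in the optimum). A deterministic algorithm is $c$-competitive if its makespan $\mathrm{ALG}$ satisfies $\mathrm{ALG}\le c\cdot\mathrm{OPT}$ on every instance. The ratio $u_j/t_j$ is interpreted as $+\infty$ when $t_j=0$. *)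

theory Defs
  imports "HOL-Library.FuncSet" "HOL-Library.Extended_Real"
begin

definition phi :: real where
  "phi = (1 + sqrt 5) / 2"

text \<open>Jobs are the numbers below \<open>num_jobs\<close>, machines the numbers below \<open>m\<close>.\<close>

record instance_data =
  num_jobs :: nat
  test_time :: "nat \<Rightarrow> real"
  upper_bound :: "nat \<Rightarrow> real"
  proc_time :: "nat \<Rightarrow> real"

definition jobs :: "instance_data \<Rightarrow> nat set" where
  "jobs I = {..<num_jobs I}"

definition valid_instance :: "instance_data \<Rightarrow> bool" where
  "valid_instance I \<longleftrightarrow>
     (\<forall>j\<in>jobs I. 0 \<le> test_time I j \<and> 0 \<le> upper_bound I j \<and>
        0 \<le> proc_time I j \<and> proc_time I j \<le> upper_bound I j)"

text \<open>
  In the non-preemptive setting with makespan objective, a schedule is determined up to the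
  irrelevant order of the jobs on each machine by the set of jobs that are tested and by the
  machine each job is run on.
\<close>

record schedule =
  tested :: "nat set"
  machine_of :: "nat \<Rightarrow> nat"

definition feasible :: "nat \<Rightarrow> instance_data \<Rightarrow> schedule \<Rightarrow> bool" where
  "feasible m I S \<longleftrightarrow> tested S \<subseteq> jobs I \<and> machine_of S \<in> jobs I \<rightarrow>\<^sub>E {..<m}"

definition occupation :: "instance_data \<Rightarrow> schedule \<Rightarrow> nat \<Rightarrow> real" where
  "occupation I S j =
     (if j \<in> tested S then test_time I j + proc_time I j else upper_bound I j)"

definition load :: "instance_data \<Rightarrow> schedule \<Rightarrow> nat set \<Rightarrow> nat \<Rightarrow> real" where
  "load I S J i = (\<Sum>j \<in> {j \<in> J. machine_of S j = i}. occupation I S j)"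

definition makespan :: "nat \<Rightarrow> instance_data \<Rightarrow> schedule \<Rightarrow> real" where
  "makespan m I S = Max (load I S (jobs I) ` {..<m})"

text \<open>The offline scheduler chooses both which jobs to test and the assignment to machines.\<close>

definition OPT :: "nat \<Rightarrow> instance_data \<Rightarrow> real" where
  "OPT m I = Min (makespan m I ` {S. feasible m I S})"

text \<open>
  An algorithm is given by the set of its possible outputs on each instance, so that a bound
  holds for all ways of resolving the choices left open in its description.
\<close>

definition competitive :: "nat \<Rightarrow> (instance_data \<Rightarrow> schedule set) \<Rightarrow> real \<Rightarrow> bool" where
  "competitive m A c \<longleftrightarrow>
     (\<forall>I. valid_instance I \<longrightarrow> (\<forall>S\<in>A I. makespan m I S \<le> c * OPT m I))"

definition ratio :: "instance_data \<Rightarrow> nat \<Rightarrow> ereal" where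
  "ratio I j =
     (if test_time I j = 0 then \<infinity> else ereal (upper_bound I j / test_time I j))"

definition least_loaded :: "nat \<Rightarrow> (nat \<Rightarrow> real) \<Rightarrow> nat \<Rightarrow> bool" where
  "least_loaded m L i \<longleftrightarrow> i < m \<and> (\<forall>k<m. L i \<le> L k)"

text \<open>
  \<open>els_run m I js S\<close>: having considered the jobs \<open>js\<close> in this order, the algorithm may have
  built the partial schedule \<open>S\<close>; ties between least-loaded machines are broken arbitrarily.
\<close>

inductive els_run :: "nat \<Rightarrow> instance_data \<Rightarrow> nat list \<Rightarrow> schedule \<Rightarrow> bool"
  for m :: nat and I :: instance_data where
  start: "els_run m I [] \<lparr>tested = {}, machine_of = (\<lambda>_. undefined)\<rparr>"
| step: "els_run m I (js @ [j])
           \<lparr>tested = (if ratio I j \<ge> ereal phi then insert j (tested S) else tested S),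
            machine_of = (machine_of S)(j := i)\<rparr>"
  if "els_run m I js S" and "least_loaded m (load I S (set js)) i"

definition job_order :: "instance_data \<Rightarrow> nat list \<Rightarrow> bool" where
  "job_order I js \<longleftrightarrow> distinct js \<and> set js = jobs I"

definition extended_list_scheduling :: "nat \<Rightarrow> instance_data \<Rightarrow> schedule set" where
  "extended_list_scheduling m I = {S. \<exists>js. job_order I js \<and> els_run m I js S}"

text \<open>
  The minimum in \<^const>\<open>OPT\<close> is over a finite nonempty set, and for every order the algorithm
  does produce a feasible schedule.
\<close>

lemma finite_feasible: "finite {S. feasible m I S}"
proof -
  have "{S. feasible m I S} \<subseteq>
      (\<lambda>(T, f). \<lparr>tested = T, machine_of = f\<rparr>) ` (Pow (jobs I) \<times> (jobs I \<rightarrow>\<^sub>E {..<m}))"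
  proof
    fix S assume "S \<in> {S. feasible m I S}"
    then show "S \<in> (\<lambda>(T, f). \<lparr>tested = T, machine_of = f\<rparr>) `
        (Pow (jobs I) \<times> (jobs I \<rightarrow>\<^sub>E {..<m}))"
      by (intro image_eqI[of _ _ "(tested S, machine_of S)"]) (auto simp: feasible_def)
  qed
  moreover have "finite (Pow (jobs I) \<times> (jobs I \<rightarrow>\<^sub>E {..<m}))"
    by (simp add: jobs_def finite_PiE)
  ultimately show ?thesis
    by (meson finite_imageI finite_subset)
qed

lemma els_run_partial:
  assumes "els_run m I js S"
  shows "tested S \<subseteq> set js \<and> machine_of S \<in> set js \<rightarrow>\<^sub>E {..<m}"
  using assms
  by (induction rule: els_run.induct)
    (auto simp: least_loaded_def PiE_def extensional_def Pi_def)

lemma els_run_exists: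
  assumes "m \<ge> 1"
  shows "\<exists>S. els_run m I js S"
proof (induction js rule: rev_induct)
  case Nil
  show ?case by (blast intro: els_run.start)
next
  case (snoc j js)
  then obtain S where S: "els_run m I js S" by blast
  have "finite {..<m}" "{..<m} \<noteq> {}" using assms by (auto simp: lessThan_empty_iff)
  then obtain i where "i \<in> {..<m}" "\<forall>k\<in>{..<m}. load I S (set js) i \<le> load I S (set js) k"
    using ex_is_arg_min_if_finite[of "{..<m}" "load I S (set js)"]
    by (auto simp: is_arg_min_linorder)
  then have "least_loaded m (load I S (set js)) i" by (auto simp: least_loaded_def)
  with S show ?case by (blast intro: els_run.step)
qed

lemma els_run_feasible:
  assumes "job_order I js" "els_run m I js S"
  shows "feasible m I S"
  using els_run_partial[OF assms(2)] assms(1) by (simp add: feasible_def job_order_def)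

lemma ex_job_order: "\<exists>js. job_order I js"
  by (rule exI[of _ "[0..<num_jobs I]"]) (auto simp: job_order_def jobs_def)

lemma ex_feasible:
  assumes "m \<ge> 1"
  shows "\<exists>S. feasible m I S"
  using assms ex_job_order els_run_exists els_run_feasible by meson

end

theory Submission imports Defs begin

text \<open>
  The threshold \<open>\<phi>\<close> balances the two possible mistakes: since \<open>\<phi>\<^sup>2 = \<phi> + 1\<close>, the time spent on any
  job is at most \<open>\<phi>\<close> times its optimal time \<open>min (t + p) u\<close>. Hence Graham's bound for list
  scheduling applies with both the largest job and the average load bounded by \<open>\<phi> OPT\<close>.
  For tightness take \<open>m (m - 1)\<close> jobs with \<open>t = 1\<close> followed by one job with \<open>t = m\<close>, where
  always \<open>u = p = \<phi> t\<close>: the algorithm tests every job and spends \<open>\<phi>\<^sup>2 t\<close> on it, balances the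
  small jobs perfectly, and then puts the large one on top of a load of \<open>(m - 1) \<phi>\<^sup>2\<close>,
  whereas running everything untested allows makespan \<open>m \<phi>\<close>.
\<close>

section \<open>The golden ratio and the loss on a single job\<close>

lemma phi_gt_one: "phi > 1"
proof -
  have "sqrt 5 > sqrt 1" by (subst real_sqrt_less_iff) simp
  then show ?thesis by (simp add: phi_def)
qed

lemma phi_square: "phi * phi = phi + 1"
proof -
  have "sqrt 5 * sqrt 5 = (5::real)" by simp
  then show ?thesis by (simp add: phi_def field_simps)
qed

text \<open>The decision to test depends only on the job, so this time refers to no schedule. Loads
  can therefore be compared between different stages of a run.\<close>

definition els_time :: "instance_data \<Rightarrow> nat \<Rightarrow> real" where
  "els_time I j =
     (if ratio I j \<ge> ereal phi then test_time I j + proc_time I j else upper_bound I j)"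

lemma els_time_nonneg:
  assumes "valid_instance I" "j \<in> jobs I"
  shows "0 \<le> els_time I j"
  using assms by (auto simp: els_time_def valid_instance_def)

text \<open>The comparison is with an arbitrary schedule \<open>S\<close>, so both of its choices
  for \<open>j\<close> must be covered. If the algorithm tests, the critical rival is
  \<open>u\<close>, where the threshold bounds \<open>t\<close> by \<open>(phi - 1) * u\<close> and
  \<open>p\<close> is at most \<open>u\<close>. If it does not test, the critical rival is
  \<open>t + p\<close>, where \<open>u < phi * t\<close> is enough.\<close>

lemma els_time_le_phi_occupation:
  assumes "valid_instance I" "j \<in> jobs I"
  shows "els_time I j \<le> phi * occupation I S j"
proof -
  define t u p where tup: "t = test_time I j" "u = upper_bound I j" "p = proc_time I j"
  have b: "0 \<le> t" "0 \<le> u" "0 \<le> p" "p \<le> u"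
    using assms by (auto simp: valid_instance_def tup)
  have mono: "x \<le> phi * x" if "0 \<le> x" for x
    using mult_right_mono[of 1 phi x] phi_gt_one that by simp
  have "els_time I j \<le> phi * (t + p) \<and> els_time I j \<le> phi * u"
  proof (cases "ratio I j \<ge> ereal phi")
    case True
    \<comment> \<open>The disjunct \<open>t = 0\<close> is the convention of an infinite ratio; it
      yields the same inequality because \<open>u\<close> is nonnegative.\<close>
    then have "t = 0 \<or> phi * t \<le> u"
      using b by (auto simp: ratio_def tup field_simps split: if_splits)
    then have "(phi - 1) * (phi * t) \<le> (phi - 1) * u"
      using b phi_gt_one by (intro mult_left_mono) auto
    moreover have "(phi - 1) * (phi * t) = t"
      using phi_square by (simp add: algebra_simps flip: mult.assoc)
    ultimately have "t \<le> (phi - 1) * u" by simp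
    then have "t + p \<le> phi * u" using b by (simp add: algebra_simps)
    then show ?thesis using True mono[of "t + p"] b by (simp add: els_time_def tup)
  next
    case False
    then have "u < phi * t"
      using b by (auto simp: ratio_def tup field_simps split: if_splits)
    also have "\<dots> \<le> phi * (t + p)" using b phi_gt_one by simp
    finally show ?thesis using False mono[of u] b by (simp add: els_time_def tup)
  qed
  then show ?thesis by (simp add: occupation_def tup)
qed

section \<open>Loads along a run, and Graham's bound\<close>

lemma occupation_els_run:
  assumes "els_run m I js S" "j \<in> set js"
  shows "occupation I S j = els_time I j"
proof -
  have "j \<in> set js \<Longrightarrow> j \<in> tested S \<longleftrightarrow> ratio I j \<ge> ereal phi" for j
    using assms(1)
  proof (induction arbitrary: j rule: els_run.induct)
    case (step js S i k)
    \<comment> \<open>Only jobs already considered lie in \<open>tested S\<close>, so a fresh job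
      below the threshold is not in it by accident.\<close>
    then show ?case using els_run_partial[OF step.hyps(1)] by auto
  qed simp
  with assms(2) show ?thesis by (simp add: occupation_def els_time_def)
qed

lemma load_els_run:
  assumes "els_run m I js S"
  shows "load I S (set js) k = (\<Sum>j \<in> {j \<in> set js. machine_of S j = k}. els_time I j)"
  unfolding load_def by (rule sum.cong) (auto simp: occupation_els_run[OF assms])

text \<open>Undoes the last step of a run. As \<open>j\<close> is fresh, updating
  \<open>machine_of\<close> at \<open>j\<close> moves no earlier job. The equation for sets serves
  to count jobs, the one for loads serves Graham's argument.\<close>

lemma els_run_snocE:
  assumes "els_run m I (js @ [j]) S'" "j \<notin> set js"
  obtains S i where "els_run m I js S" "least_loaded m (load I S (set js)) i"
    "\<And>k. {x \<in> set (js @ [j]). machine_of S' x = k} =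
       {x \<in> set js. machine_of S x = k} \<union> (if k = i then {j} else {})"
    "\<And>k. load I S' (set (js @ [j])) k =
       load I S (set js) k + (if k = i then els_time I j else 0)"
  using assms(1)
proof cases
  case (step js' S i j')
  then have eq: "js' = js" "j' = j" by auto
  have sets: "{x \<in> set (js @ [j]). machine_of S' x = k} =
      {x \<in> set js. machine_of S x = k} \<union> (if k = i then {j} else {})" for k
    using assms(2) step eq by auto
  have loads: "load I S' (set (js @ [j])) k =
       load I S (set js) k + (if k = i then els_time I j else 0)" for k
    unfolding load_els_run[OF assms(1)] sets
    using assms(2) load_els_run[of m I js S k] step(3) eq by (simp add: add.commute)
  show ?thesis by (rule that[OF step(3,4)[unfolded eq] sets loads])
qed simp

lemma sum_load:
  assumes "finite J" "machine_of S \<in> J \<rightarrow> {..<m}"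
  shows "(\<Sum>i<m. load I S J i) = (\<Sum>j\<in>J. occupation I S j)"
  unfolding load_def using assms by (intro sum.group) auto

lemma sum_load_els_run:
  assumes "els_run m I js S"
  shows "(\<Sum>i<m. load I S (set js) i) = (\<Sum>j\<in>set js. els_time I j)"
  using els_run_partial[OF assms]
  by (subst sum_load) (auto simp: PiE_def occupation_els_run[OF assms] intro!: sum.cong)

text \<open>Only the machine receiving the last job \<open>j\<close> needs a new argument. It was
  least loaded, so its load was at most the average \<open>c - els_time I j / m\<close>; adding
  \<open>els_time I j <= c\<close> gives the bound. The other machines are covered by induction,
  since nonnegative times pass the bound on the total down to prefixes.\<close>

lemma list_scheduling_bound:
  assumes "m \<ge> 1" "els_run m I js S" "distinct js" "k < m" "0 \<le> c"
    and "\<And>j. j \<in> set js \<Longrightarrow> 0 \<le> els_time I j"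
    and "\<And>j. j \<in> set js \<Longrightarrow> els_time I j \<le> c"
    and "(\<Sum>j\<in>set js. els_time I j) \<le> real m * c"
  shows "load I S (set js) k \<le> (2 - 1 / real m) * c"
  using assms(2-)
proof (induction js arbitrary: S k rule: rev_induct)
  case Nil
  moreover have "1 / real m \<le> 2" using \<open>m \<ge> 1\<close> by (simp add: field_simps)
  ultimately show ?case by (simp add: load_def)
next
  case (snoc j js)
  have jn: "j \<notin> set js" using snoc.prems by simp
  obtain S0 i where S0: "els_run m I js S0"
    and i: "least_loaded m (load I S0 (set js)) i"
    and L: "\<And>k. load I S (set (js @ [j])) k =
       load I S0 (set js) k + (if k = i then els_time I j else 0)"
    by (rule els_run_snocE[OF snoc.prems(1) jn]) (rule that)
  have tot: "(\<Sum>j\<in>set js. els_time I j) + els_time I j \<le> real m * c"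
    using snoc.prems by (simp add: add.commute)
  have j: "0 \<le> els_time I j" "els_time I j \<le> c" using snoc.prems by auto
  show ?case
  proof (cases "k = i")
    case False
    then show ?thesis
      unfolding L using snoc.IH[OF S0, of k] snoc.prems tot j by simp
  next
    case True
    have "real m * load I S0 (set js) i \<le> (\<Sum>k<m. load I S0 (set js) k)"
      using sum_bounded_below[of "{..<m}" "load I S0 (set js) i"] i
      by (auto simp: least_loaded_def)
    also have "\<dots> \<le> real m * c - els_time I j"
      using sum_load_els_run[OF S0] tot by simp
    finally have "real m * (load I S0 (set js) i + els_time I j)
        \<le> real m * c + (real m - 1) * els_time I j"
      by (simp add: algebra_simps)
    also have "\<dots> \<le> real m * c + (real m - 1) * c"
      using j \<open>m \<ge> 1\<close> by (intro add_left_mono mult_left_mono) auto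
    finally show ?thesis unfolding L using True \<open>m \<ge> 1\<close> by (simp add: field_simps)
  qed
qed

section \<open>The optimum and competitiveness\<close>

lemma OPT_attained:
  assumes "m \<ge> 1"
  obtains S where "feasible m I S" "makespan m I S = OPT m I"
proof -
  have "OPT m I \<in> makespan m I ` {S. feasible m I S}"
    unfolding OPT_def using finite_feasible ex_feasible[OF assms] by (intro Min_in) auto
  then show ?thesis using that by auto
qed

lemma OPT_le_makespan: "feasible m I S \<Longrightarrow> OPT m I \<le> makespan m I S"
  unfolding OPT_def using finite_feasible by (intro Min_le) auto

lemma load_le_makespan: "k < m \<Longrightarrow> load I S (jobs I) k \<le> makespan m I S"
  unfolding makespan_def by (intro Max_ge) auto

lemma makespan_le:
  assumes "m \<ge> 1" "\<And>k. k < m \<Longrightarrow> load I S (jobs I) k \<le> c"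
  shows "makespan m I S \<le> c"
  unfolding makespan_def using assms by (subst Max_le_iff) (auto simp: lessThan_empty_iff)

lemma extended_list_scheduling_competitive:
  assumes "m \<ge> 1"
  shows "competitive m (extended_list_scheduling m) (phi * (2 - 1 / real m))"
  unfolding competitive_def
proof (intro allI impI ballI)
  fix I S assume v: "valid_instance I" and "S \<in> extended_list_scheduling m I"
  then obtain js where js: "distinct js" "set js = jobs I" "els_run m I js S"
    by (auto simp: extended_list_scheduling_def job_order_def)
  \<comment> \<open>Both of Graham's lower bounds, the largest job and the average load, are read
    off one optimal schedule \<open>T\<close> and carried over to \<open>els_time\<close> at the
    cost of a factor \<open>phi\<close>.\<close>
  obtain T where T: "feasible m I T" "makespan m I T = OPT m I"
    using OPT_attained[OF assms] by blast
  have occ: "0 \<le> occupation I T j" if "j \<in> jobs I" for j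
    using v that by (auto simp: occupation_def valid_instance_def)
  have fin: "finite (jobs I)" by (simp add: jobs_def)
  have occ_le: "occupation I T j \<le> OPT m I" if "j \<in> jobs I" for j
  proof -
    have "occupation I T j \<le> load I T (jobs I) (machine_of T j)"
      unfolding load_def using that occ fin by (intro member_le_sum) auto
    also have "\<dots> \<le> OPT m I"
      using T that load_le_makespan[of "machine_of T j" m I T] by (auto simp: feasible_def)
    finally show ?thesis .
  qed
  have "0 \<le> load I T (jobs I) 0" unfolding load_def using occ by (intro sum_nonneg) auto
  then have nonneg: "0 \<le> OPT m I" using load_le_makespan[of 0 m I T] T assms by simp
  have "(\<Sum>j\<in>jobs I. els_time I j) \<le> (\<Sum>j\<in>jobs I. phi * occupation I T j)"
    using els_time_le_phi_occupation[OF v] by (intro sum_mono)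
  also have "\<dots> = phi * (\<Sum>i<m. load I T (jobs I) i)"
    using T fin by (subst sum_load) (auto simp: feasible_def PiE_def sum_distrib_left)
  also have "\<dots> \<le> phi * (real m * OPT m I)"
    using phi_gt_one sum_bounded_above[of "{..<m}" "load I T (jobs I)" "OPT m I"]
      load_le_makespan[of _ m I T] T by (intro mult_left_mono) auto
  finally have tot: "(\<Sum>j\<in>jobs I. els_time I j) \<le> real m * (phi * OPT m I)"
    by (simp add: ac_simps)
  have max: "els_time I j \<le> phi * OPT m I" if "j \<in> jobs I" for j
    using els_time_le_phi_occupation[OF v that, of T] occ_le[OF that] phi_gt_one
    by (smt (verit) mult_left_mono)
  have "load I S (jobs I) k \<le> (2 - 1 / real m) * (phi * OPT m I)" if "k < m" for k
    using list_scheduling_bound[OF assms js(3,1) that, of "phi * OPT m I"]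
      tot max els_time_nonneg[OF v] nonneg phi_gt_one by (simp add: js(2))
  then show "makespan m I S \<le> phi * (2 - 1 / real m) * OPT m I"
    by (intro makespan_le[OF assms]) (simp add: ac_simps)
qed

section \<open>Tightness: equal jobs are balanced, then one large job follows\<close>

lemma els_run_uniform_balanced:
  assumes "els_run m I js S" "distinct js" "w > 0" "\<And>j. j \<in> set js \<Longrightarrow> els_time I j = w"
    and "k < m" "l < m"
  shows "card {x \<in> set js. machine_of S x = k} \<le> card {x \<in> set js. machine_of S x = l} + 1"
  using assms
proof (induction js arbitrary: S k l rule: rev_induct)
  case (snoc j js)
  have jn: "j \<notin> set js" using snoc.prems by simp
  obtain S0 i where S0: "els_run m I js S0"
    and i: "least_loaded m (load I S0 (set js)) i"
    and sets: "\<And>k. {x \<in> set (js @ [j]). machine_of S x = k} =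
       {x \<in> set js. machine_of S0 x = k} \<union> (if k = i then {j} else {})"
    by (rule els_run_snocE[OF snoc.prems(1) jn]) (rule that)
  define c where "c k = card {x \<in> set js. machine_of S0 x = k}" for k
  have card: "card {x \<in> set (js @ [j]). machine_of S x = k} = c k + (if k = i then 1 else 0)" for k
    unfolding sets c_def using jn by auto
  \<comment> \<open>With equal times a least-loaded machine is one with the fewest jobs. Placing a
    job there keeps all counts within one of each other, however ties are broken.\<close>
  have "load I S0 (set js) k = real (c k) * w" for k
    unfolding load_els_run[OF S0] c_def using snoc.prems by simp
  then have least: "c i \<le> c l"
    using i snoc.prems by (auto simp: least_loaded_def)
  have "c k \<le> c l + 1"
    unfolding c_def using snoc.prems by (intro snoc.IH[OF S0]) auto
  then show ?case unfolding card using least by auto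
qed simp

text \<open>If some machine had fewer than \<open>q\<close> jobs, balance would leave at most
  \<open>q\<close> on every machine, hence fewer than \<open>m * q\<close> in total.\<close>

lemma els_run_uniform_load_ge:
  assumes "els_run m I js S" "distinct js" "w > 0" "\<And>j. j \<in> set js \<Longrightarrow> els_time I j = w"
    and "length js = m * q" "k < m"
  shows "real q * w \<le> load I S (set js) k"
proof -
  define c where "c k = card {x \<in> set js. machine_of S x = k}" for k
  have "(\<Sum>i<m. c i) = (\<Sum>i<m. \<Sum>x\<in>{x \<in> set js. machine_of S x = i}. 1)"
    by (simp add: c_def)
  also have "\<dots> = (\<Sum>x\<in>set js. 1)"
    using els_run_partial[OF assms(1)] by (intro sum.group) (auto simp: PiE_def)
  finally have total: "(\<Sum>i<m. c i) = m * q"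
    using assms by (simp add: distinct_card)
  have "q \<le> c k"
  proof (rule ccontr)
    assume less: "\<not> q \<le> c k"
    have "c i \<le> q" if "i < m" for i
      using els_run_uniform_balanced[OF assms(1-4) that assms(6)] less by (simp add: c_def)
    then have "(\<Sum>i<m. c i) < (\<Sum>i<m. q)"
      using less assms(6) by (intro sum_strict_mono_ex1) (auto intro!: bexI[of _ k])
    then show False using total by simp
  qed
  moreover have "load I S (set js) k = real (c k) * w"
    unfolding load_els_run[OF assms(1)] c_def using assms(4) by simp
  ultimately show ?thesis using assms(3) by simp
qed

definition tight_size :: "nat \<Rightarrow> nat \<Rightarrow> real" where
  "tight_size m j = (if j < m * (m - 1) then 1 else real m)"

definition tight_instance :: "nat \<Rightarrow> instance_data" where
  "tight_instance m =
     \<lparr>num_jobs = m * (m - 1) + 1, test_time = tight_size m,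
      upper_bound = (\<lambda>j. phi * tight_size m j), proc_time = (\<lambda>j. phi * tight_size m j)\<rparr>"

lemma valid_tight_instance: "valid_instance (tight_instance m)"
  using phi_gt_one by (auto simp: valid_instance_def tight_instance_def tight_size_def)

text \<open>Each ratio equals \<open>phi\<close> exactly, so the non-strict threshold forces a test,
  and \<open>t + p\<close> is \<open>1 + phi\<close> times the size.\<close>

lemma els_time_tight_instance:
  assumes "m \<ge> 1"
  shows "els_time (tight_instance m) j = phi * phi * tight_size m j"
  using assms unfolding phi_square
  by (simp add: els_time_def ratio_def tight_instance_def tight_size_def algebra_simps)

lemma OPT_tight_instance_le:
  assumes "m \<ge> 1"
  shows "OPT m (tight_instance m) \<le> real m * phi"
proof -
  \<comment> \<open>Division by \<open>m\<close> sends each block of \<open>m\<close> consecutive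
    small jobs to one of the first \<open>m - 1\<close> machines and leaves the large job, of index
    \<open>m * (m - 1)\<close>, alone on the last.\<close>
  define S where "S = \<lparr>tested = {}, machine_of = (\<lambda>j\<in>jobs (tight_instance m). j div m)\<rparr>"
  have jobs: "jobs (tight_instance m) = {..m * (m - 1)}"
    by (auto simp: jobs_def tight_instance_def)
  have S_fields: "tested S = {}" "j \<le> m * (m - 1) \<Longrightarrow> machine_of S j = j div m" for j
    by (simp_all add: S_def jobs)
  have upper: "upper_bound (tight_instance m) j = phi * tight_size m j" for j
    by (simp add: tight_instance_def)
  have "j div m < m" if "j \<le> m * (m - 1)" for j
    using div_le_mono[OF that, of m] assms by simp
  then have feas: "feasible m (tight_instance m) S"
    by (auto simp: feasible_def S_def jobs)
  have "load (tight_instance m) S (jobs (tight_instance m)) k \<le> real m * phi" if k: "k < m" for k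
  proof -
    define J where "J = {j \<in> {..m * (m - 1)}. j div m = k}"
    have "load (tight_instance m) S (jobs (tight_instance m)) k = (\<Sum>j\<in>J. phi * tight_size m j)"
      unfolding load_def J_def jobs
      by (rule sum.cong) (auto simp: S_fields occupation_def upper)
    also have "\<dots> \<le> real m * phi"
    proof (cases "k = m - 1")
      case True
      have "J = {m * (m - 1)}"
      proof -
        have "j = m * (m - 1)" if "j \<in> J" for j
          using that True div_mult_mod_eq[of j m] by (auto simp: J_def mult.commute)
        moreover have "m * (m - 1) \<in> J" using True assms by (simp add: J_def)
        ultimately show ?thesis by blast
      qed
      then show ?thesis by (simp add: tight_size_def)
    next
      case False
      have sub: "J \<subseteq> {k * m..<k * m + m}"
      proof
        fix j assume "j \<in> J"
        then have "j = k * m + j mod m" using div_mult_mod_eq[of j m] by (simp add: J_def)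
        moreover have "j mod m < m" using assms by simp
        ultimately show "j \<in> {k * m..<k * m + m}" unfolding atLeastLessThan_iff by linarith
      qed
      have small: "j < m * (m - 1)" if "j \<in> J" for j
      proof -
        have "j \<noteq> m * (m - 1)" using that False assms by (auto simp: J_def)
        then show ?thesis using that by (simp add: J_def)
      qed
      have "(\<Sum>j\<in>J. phi * tight_size m j) = real (card J) * phi"
        using small by (simp add: tight_size_def)
      moreover have "card J \<le> m" using card_mono[OF _ sub] by simp
      ultimately show ?thesis using phi_gt_one by simp
    qed
    finally show ?thesis .
  qed
  then have "makespan m (tight_instance m) S \<le> real m * phi"
    by (rule makespan_le[OF assms])
  with OPT_le_makespan[OF feas] show ?thesis by linarith
qed

lemma makespan_tight_instance_ge:
  assumes "m \<ge> 1" "els_run m (tight_instance m) [0..<m * (m - 1) + 1] S"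
  shows "phi * phi * (2 * real m - 1) \<le> makespan m (tight_instance m) S"
proof -
  let ?I = "tight_instance m" and ?js = "[0..<m * (m - 1)]"
  have upt: "[0..<m * (m - 1) + 1] = ?js @ [m * (m - 1)]" by simp
  have run: "els_run m ?I (?js @ [m * (m - 1)]) S" using assms(2) unfolding upt .
  have new: "m * (m - 1) \<notin> set ?js" by simp
  obtain S0 i where S0: "els_run m ?I ?js S0"
    and i: "least_loaded m (load ?I S0 (set ?js)) i"
    and L: "\<And>k. load ?I S (set (?js @ [m * (m - 1)])) k =
       load ?I S0 (set ?js) k + (if k = i then els_time ?I (m * (m - 1)) else 0)"
    by (rule els_run_snocE[OF run new]) (rule that)
  have im: "i < m" using i by (simp add: least_loaded_def)
  have jobs: "jobs ?I = set (?js @ [m * (m - 1)])"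
    by (auto simp: jobs_def tight_instance_def)
  \<comment> \<open>The balance lemma with \<open>q = m - 1\<close> and
    \<open>w = phi * phi\<close>; it holds for every machine, hence for whichever \<open>i\<close>
    receives the large job.\<close>
  have "real (m - 1) * (phi * phi) \<le> load ?I S0 (set ?js) i"
    using phi_gt_one assms(1)
    by (intro els_run_uniform_load_ge[OF S0 _ _ _ _ im])
      (auto simp: els_time_tight_instance tight_size_def)
  then have "phi * phi * (2 * real m - 1) \<le> load ?I S (jobs ?I) i"
    using assms(1) unfolding jobs L
    by (simp add: els_time_tight_instance tight_size_def of_nat_diff algebra_simps)
  then show ?thesis using load_le_makespan[OF im] by (rule order_trans)
qed

theorem theorem2:
  fixes m :: nat
  assumes "m \<ge> 1"
  shows "competitive m (extended_list_scheduling m) (phi * (2 - 1 / real m)) \<and>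
    (\<exists>I js. valid_instance I \<and> job_order I js \<and> OPT m I > 0 \<and>
       (\<exists>S. els_run m I js S) \<and>
       (\<forall>S. els_run m I js S \<longrightarrow> makespan m I S = phi * (2 - 1 / real m) * OPT m I))"
proof -
  let ?I = "tight_instance m" and ?js = "[0..<m * (m - 1) + 1]" and ?c = "phi * (2 - 1 / real m)"
  note comp = extended_list_scheduling_competitive[OF assms]
  have order: "job_order ?I ?js" by (auto simp: job_order_def jobs_def tight_instance_def)
  have c_pos: "?c > 0" using phi_gt_one assms by (simp add: field_simps)
  \<comment> \<open>Competitiveness also closes the equality: the makespan is at most
    \<open>?c * OPT m ?I\<close>, which is at most \<open>?c * (real m * phi)\<close>, which is at
    most the makespan. This sandwich replaces a separate lower bound on the optimum and also shows
    that it is positive.\<close>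
  have upper: "makespan m ?I S \<le> ?c * OPT m ?I" if "els_run m ?I ?js S" for S
    using comp valid_tight_instance order that
    unfolding competitive_def extended_list_scheduling_def by blast
  have "?c * (real m * phi) = phi * phi * (2 * real m - 1)"
    using assms by (simp add: field_simps)
  then have lower: "?c * (real m * phi) \<le> makespan m ?I S" if "els_run m ?I ?js S" for S
    using makespan_tight_instance_ge[OF assms that] by (simp only:)
  have opt: "?c * OPT m ?I \<le> ?c * (real m * phi)"
    using OPT_tight_instance_le[OF assms] less_imp_le[OF c_pos] by (rule mult_left_mono)
  obtain S where S: "els_run m ?I ?js S" using els_run_exists[OF assms] by blast
  have "0 < real m * phi" using phi_gt_one assms by simp
  with c_pos have "0 < ?c * (real m * phi)" by (rule mult_pos_pos)
  then have "0 < ?c * OPT m ?I" using upper[OF S] lower[OF S] by linarith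
  then have "OPT m ?I > 0" using c_pos by (rule zero_less_mult_pos)
  moreover have "makespan m ?I S = ?c * OPT m ?I" if "els_run m ?I ?js S" for S
    using upper[OF that] lower[OF that] opt by linarith
  ultimately show ?thesis using comp valid_tight_instance order S by blast
qed

end
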